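(* Let $k\geq3$ be odd and let $d$ be an integer with $d\geq\frac{3^k}{2k}+1$. Then $C_{d,k}\geq 2k\left(\lfloor\frac{d}{2}\rfloor\right)^{k}$.
   Context: A Cayley digraph $Cay(\Gamma,X)$ of a group $\Gamma$ with respect to a generating set $X$ not containing the identity has vertex set $\Gamma$ and an arc from $u$ to $v$ iff $ux=v$ for some $x\in X$; its degree is $|X|$. $C_{d,k}$ denotes the largest number of vertices of a Cayley digraph of degree $d$ and diameter $k$ (diameter = maximum directed distance). *)

theory Defs
  imports
    "HOL-Algebra.Generated_Groups"
    "Graph_Theory.Pair_Digraph"
    "Graph_Theory.Shortest_Path"
begin

definition cayley_digraph :: "('a, 'b) monoid_scheme \<Rightarrow> 'a set \<Rightarrow> ('a, 'a \<times> 'a) pre_digraph" where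
  "cayley_digraph G X = with_proj
     \<lparr>pverts = carrier G,
      parcs = {(u, v). u \<in> carrier G \<and> v \<in> carrier G \<and> (\<exists>x\<in>X. u \<otimes>\<^bsub>G\<^esub> x = v)}\<rparr>"

text \<open>With every arc of weight 1, the shortest-path weight \<open>\<mu>\<close> is the directed distance,
  with value \<open>\<infinity>\<close> if there is no directed walk.\<close>

definition digraph_diameter :: "('a, 'b) pre_digraph \<Rightarrow> ereal" where
  "digraph_diameter D =
     (SUP u\<in>verts D. SUP v\<in>verts D. wf_digraph.\<mu> D (\<lambda>_. 1) u v)"

text \<open>The possible orders of Cayley digraphs of degree \<open>d\<close> and diameter exactly \<open>k\<close>.
  Taking carriers inside \<^typ>\<open>nat\<close> covers every finite group up to isomorphism; infinite
  groups cannot occur, since \<open>d\<close> and \<open>k\<close> are finite.\<close>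

definition cayley_orders :: "nat \<Rightarrow> nat \<Rightarrow> nat set" where
  "cayley_orders d k =
     {order G | (G :: nat monoid) X.
        group G \<and> finite (carrier G) \<and>
        X \<subseteq> carrier G \<and> generate G X = carrier G \<and> \<one>\<^bsub>G\<^esub> \<notin> X \<and>
        card X = d \<and> digraph_diameter (cayley_digraph G X) = ereal (real k)}"

text \<open>The set of orders is finite by the directed Moore bound; if it is empty, the value is
  unspecified.\<close>

definition cayley_number :: "nat \<Rightarrow> nat \<Rightarrow> nat" where
  "cayley_number d k = Max (cayley_orders d k)"

end

(*
Idea. Take the group of triples (f, p, e), where f assigns to every cell in Z/k a value in Z/m,
p in Z/k is the position of a head and e = 1, -1 its direction. It has order 2k m^k. There are 2m
generators: "Advance" adds an arbitrary value to the cell p + 3e and moves the head to p + 4e;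
"Turn" adds an arbitrary value to both cells p + e and p + 3e and reverses the head.

Fix a word of k such letters. The contributions to f add up, so every f is reached as soon as the
subgroup generated by the advanced-over cells and the sums of the turned-at pairs is everything.
Since consecutive letters of type Turn link neighbouring cells, it suffices that every cell is
linked to one written by an Advance. The block Advance, Turn, Turn, Advance fills a whole interval
of 8 steps, whereas a run of Advances fills only every second cell and has to be complemented by
a later run. For odd k eight families of words do this, and they lead to all 2k final positions.

With m = d div 2 the order exceeds 1 + d + ... + d^(k-1), which makes the diameter exactly k and
leaves room for one more generator if d is odd.
*)

theory Submission
  imports Defs "HOL-Algebra.Weak_Morphisms"
begin

section \<open>Cayley digraphs and products of generators\<close>

text \<open>Exactly \<open>n\<close> factors, not at most \<open>n\<close>: all words built below
  have the same length \<open>k\<close>. The leftmost factor is split off, as the first arc of a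
  walk is.\<close>

primrec products :: "('a, 'b) monoid_scheme \<Rightarrow> 'a set \<Rightarrow> nat \<Rightarrow> 'a set" where
  "products G X 0 = {\<one>\<^bsub>G\<^esub>}"
| "products G X (Suc n) = (\<lambda>(x, g). x \<otimes>\<^bsub>G\<^esub> g) ` (X \<times> products G X n)"

lemma finite_products: "finite X \<Longrightarrow> finite (products G X n)"
  by (induction n) auto

lemma card_products_le: "finite X \<Longrightarrow> card (products G X n) \<le> card X ^ n"
proof (induction n)
  case (Suc n)
  have "card (products G X (Suc n)) \<le> card (X \<times> products G X n)"
    unfolding products.simps by (rule card_image_le) (simp add: Suc.prems finite_products)
  also have "\<dots> \<le> card X * card X ^ n"
    using Suc by (simp add: card_cartesian_product)
  finally show ?case by simp
qed auto

lemma card_UN_products_le: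
  assumes "finite X"
  shows "card (\<Union>n<k. products G X n) \<le> (\<Sum>n<k. card X ^ n)"
  by (rule le_trans[OF card_UN_le sum_mono]) (auto simp: assms card_products_le)

lemma products_mono: "X \<subseteq> Y \<Longrightarrow> products G X n \<subseteq> products G Y n"
  by (induction n) auto

lemma (in group) products_in_carrier:
  "X \<subseteq> carrier G \<Longrightarrow> products G X n \<subseteq> carrier G"
  by (induction n) auto

lemma (in group) products_in_generate: "products G X n \<subseteq> generate G X"
  by (induction n) (auto intro: generate.intros)

lemma wf_cayley_digraph: "wf_digraph (cayley_digraph G X)"
  by unfold_locales (auto simp: cayley_digraph_def)

text \<open>The arcs leaving \<open>u\<close> are the pairs \<open>(u, u \<otimes> x)\<close>, so a
  walk of length \<open>n\<close> spells a word of \<open>n\<close> generators multiplied on the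
  right. The equivalence serves both the upper and the lower bounds on distances.\<close>

lemma (in group) awalk_cayley_digraph:
  assumes "X \<subseteq> carrier G" "u \<in> carrier G"
  shows "(\<exists>p. pre_digraph.awalk (cayley_digraph G X) u p v \<and> length p = n)
    \<longleftrightarrow> v \<in> (\<lambda>g. u \<otimes> g) ` products G X n"
  using assms(2)
proof (induction n arbitrary: u)
  case 0
  then show ?case
    by (auto simp: pre_digraph.awalk_def pre_digraph.cas.simps cayley_digraph_def)
next
  case (Suc n)
  have Cons: "pre_digraph.awalk (cayley_digraph G X) u (a # p) v \<longleftrightarrow>
      (\<exists>x\<in>X. a = (u, u \<otimes> x)) \<and> pre_digraph.awalk (cayley_digraph G X) (u \<otimes> x) p v"
    if "snd a = u \<otimes> x" "x \<in> X" for a p x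
    using that Suc.prems assms(1)
    by (auto simp: pre_digraph.awalk_def pre_digraph.cas.simps cayley_digraph_def)
  have arc: "\<exists>x\<in>X. snd a = u \<otimes> x"
    if "pre_digraph.awalk (cayley_digraph G X) u (a # p) v" for a p
    using that by (auto simp: pre_digraph.awalk_def pre_digraph.cas.simps cayley_digraph_def)
  have "(\<exists>p. pre_digraph.awalk (cayley_digraph G X) u p v \<and> length p = Suc n) \<longleftrightarrow>
      (\<exists>x\<in>X. \<exists>p. pre_digraph.awalk (cayley_digraph G X) (u \<otimes> x) p v \<and> length p = n)"
    (is "?L \<longleftrightarrow> ?R")
  proof
    assume ?L
    then obtain a p where a: "pre_digraph.awalk (cayley_digraph G X) u (a # p) v" "length p = n"
      by (auto simp: length_Suc_conv)
    then obtain x where "x \<in> X" "snd a = u \<otimes> x" using arc by blast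
    with a Cons[of a x p] show ?R by auto
  next
    assume ?R
    then obtain x p where "x \<in> X" "pre_digraph.awalk (cayley_digraph G X) (u \<otimes> x) p v"
      "length p = n" by blast
    with Cons[of "(u, u \<otimes> x)" x p] show ?L
      by (intro exI[of _ "(u, u \<otimes> x) # p"]) auto
  qed
  also have "\<dots> \<longleftrightarrow> (\<exists>x\<in>X. \<exists>g\<in>products G X n. v = u \<otimes> (x \<otimes> g))"
    using Suc.IH Suc.prems assms(1) products_in_carrier[OF assms(1), of n]
    by (auto simp: m_assoc subset_iff image_iff)
  also have "\<dots> \<longleftrightarrow> v \<in> (\<lambda>g. u \<otimes> g) ` products G X (Suc n)"
    by (force simp: image_iff)
  finally show ?case .
qed

section \<open>Distances, the directed Moore bound and the diameter\<close>

lemma awalk_cost_unit: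
  fixes p :: "('a \<times> 'a) list"
  shows "wf_digraph.awalk_cost (\<lambda>_. 1) p = real (length p)"
  \<comment> \<open>The cost does not depend on the digraph, but its definition lives in a locale; a
    Cayley digraph discharges the locale assumption.\<close>
  by (simp add: wf_digraph.awalk_cost_def[OF wf_cayley_digraph] sum_list_triv)

lemma (in group) distance_le:
  assumes "X \<subseteq> carrier G" "u \<in> carrier G" "g \<in> products G X n"
  shows "wf_digraph.\<mu> (cayley_digraph G X) (\<lambda>_. 1) u (u \<otimes> g) \<le> ereal (real n)"
proof -
  obtain p where "pre_digraph.awalk (cayley_digraph G X) u p (u \<otimes> g)" "length p = n"
    using awalk_cayley_digraph[OF assms(1,2)] assms(3) by blast
  then show ?thesis
    using wf_digraph.min_cost_le_walk_cost[OF wf_cayley_digraph] by (metis awalk_cost_unit)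
qed

text \<open>The distance is an infimum over walks, and an infimum strictly below \<open>k\<close> is
  undercut by an actual walk with fewer than \<open>k\<close> arcs.\<close>

lemma (in group) mem_products_if_distance_less:
  assumes "X \<subseteq> carrier G" "v \<in> carrier G"
    and "wf_digraph.\<mu> (cayley_digraph G X) (\<lambda>_. 1) \<one> v < ereal (real k)"
  shows "v \<in> (\<Union>n<k. products G X n)"
proof -
  obtain p where p: "pre_digraph.awalk (cayley_digraph G X) \<one> p v" "real (length p) < real k"
    using assms(3) unfolding wf_digraph.\<mu>_def[OF wf_cayley_digraph]
    by (auto simp: INF_less_iff awalk_cost_unit)
  then have "v \<in> (\<lambda>g. \<one> \<otimes> g) ` products G X (length p)"
    using awalk_cayley_digraph[OF assms(1) one_closed] by blast
  then show ?thesis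
    using p(2) products_in_carrier[OF assms(1), of "length p"] by (auto simp: subset_iff)
qed

text \<open>The directed Moore bound: words with fewer than \<open>k\<close> letters exhaust the
  group. It bounds all orders (with \<open>Suc k\<close>) and, by contraposition, the diameter from
  below.\<close>

lemma (in group) order_le_sum_powers:
  assumes "X \<subseteq> carrier G" "finite X"
    and "\<And>v. v \<in> carrier G \<Longrightarrow>
      wf_digraph.\<mu> (cayley_digraph G X) (\<lambda>_. 1) \<one> v < ereal (real k)"
  shows "order G \<le> (\<Sum>n<k. card X ^ n)"
proof -
  have "carrier G \<subseteq> (\<Union>n<k. products G X n)"
    using mem_products_if_distance_less assms by blast
  then have "order G \<le> card (\<Union>n<k. products G X n)"
    unfolding order_def by (intro card_mono) (auto simp: assms finite_products)
  then show ?thesis using card_UN_products_le[OF assms(2)] le_trans by blast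
qed

lemma finite_cayley_orders: "finite (cayley_orders d k)"
proof (rule finite_subset)
  show "cayley_orders d k \<subseteq> {..\<Sum>n<Suc k. d ^ n}"
  proof (clarsimp simp: cayley_orders_def)
    fix G :: "nat monoid" and X
    assume G: "group G" "finite (carrier G)" "X \<subseteq> carrier G"
      "digraph_diameter (cayley_digraph G X) = ereal (real k)"
    interpret group G by fact
    have "wf_digraph.\<mu> (cayley_digraph G X) (\<lambda>_. 1) \<one>\<^bsub>G\<^esub> v < ereal (real (Suc k))"
      if "v \<in> carrier G" for v
    proof -
      have "wf_digraph.\<mu> (cayley_digraph G X) (\<lambda>_. 1) \<one>\<^bsub>G\<^esub> v \<le> digraph_diameter (cayley_digraph G X)"
        unfolding digraph_diameter_def
        by (rule SUP_upper2[of "\<one>\<^bsub>G\<^esub>"], simp add: cayley_digraph_def, rule SUP_upper)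
          (use that in \<open>simp add: cayley_digraph_def\<close>)
      also have "\<dots> < ereal (real (Suc k))" by (simp add: G)
      finally show ?thesis .
    qed
    from order_le_sum_powers[OF G(3) finite_subset[OF G(3,2)] this]
    show "order G \<le> (\<Sum>n<k. card X ^ n) + card X ^ k" by simp
  qed
qed simp

text \<open>A word for \<open>inv u \<otimes> v\<close> leads from \<open>u\<close> to
  \<open>v\<close>, whence the upper bound. A smaller diameter would contradict the Moore bound
  because of \<open>big\<close>.\<close>

lemma (in group) digraph_diameter_eq:
  assumes X: "X \<subseteq> carrier G" "finite X"
    and all: "carrier G \<subseteq> products G X k"
    and big: "(\<Sum>n<k. card X ^ n) < order G"
  shows "digraph_diameter (cayley_digraph G X) = ereal (real k)"
proof (rule antisym)
  show "digraph_diameter (cayley_digraph G X) \<le> ereal (real k)"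
    unfolding digraph_diameter_def
  proof (intro SUP_least)
    fix u v assume "u \<in> verts (cayley_digraph G X)" "v \<in> verts (cayley_digraph G X)"
    then have uv: "u \<in> carrier G" "v \<in> carrier G" by (auto simp: cayley_digraph_def)
    then have "u \<otimes> (inv u \<otimes> v) = v" by (simp add: m_assoc[symmetric])
    moreover have "inv u \<otimes> v \<in> products G X k" using all uv by auto
    ultimately show "wf_digraph.\<mu> (cayley_digraph G X) (\<lambda>_. 1) u v \<le> ereal (real k)"
      using distance_le[OF X(1) uv(1), of "inv u \<otimes> v" k] by simp
  qed
  obtain v where v: "v \<in> carrier G"
    "\<not> wf_digraph.\<mu> (cayley_digraph G X) (\<lambda>_. 1) \<one> v < ereal (real k)"
    using order_le_sum_powers[OF X, of k] big by fastforce
  have "wf_digraph.\<mu> (cayley_digraph G X) (\<lambda>_. 1) \<one> v \<le> digraph_diameter (cayley_digraph G X)"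
    unfolding digraph_diameter_def
    by (rule SUP_upper2[of "\<one>"], simp add: cayley_digraph_def, rule SUP_upper)
      (use v in \<open>simp add: cayley_digraph_def\<close>)
  with v show "ereal (real k) \<le> digraph_diameter (cayley_digraph G X)" by auto
qed

section \<open>Transport to groups of natural numbers\<close>

lemma (in group) image_group_inj:
  assumes "inj_on h (carrier G)"
  shows "group (image_group h G)"
proof -
  have "h \<in> hom G (image_group h G)"
    by (auto simp: hom_def image_group_def inv_into_f_f[OF assms])
  from hom_imp_img_group[OF this] show ?thesis by (simp add: image_group_def)
qed

lemma (in group) products_image_group:
  assumes "inj_on h (carrier G)" "X \<subseteq> carrier G"
  shows "products (image_group h G) (h ` X) n = h ` products G X n"
proof (induction n)
  case 0 then show ?case by (simp add: image_group_def)
next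
  case (Suc n)
  have eq: "h x \<otimes>\<^bsub>image_group h G\<^esub> h g = h (x \<otimes> g)" if "x \<in> X" "g \<in> products G X n" for x g
    using that assms products_in_carrier[OF assms(2), of n]
    by (auto simp: image_group_def inv_into_f_f[OF assms(1)] subset_iff)
  have "products (image_group h G) (h ` X) (Suc n)
      = (\<lambda>(x, g). h x \<otimes>\<^bsub>image_group h G\<^esub> h g) ` (X \<times> products G X n)"
    by (force simp: Suc image_iff)
  also have "\<dots> = (\<lambda>(x, g). h (x \<otimes> g)) ` (X \<times> products G X n)"
    by (rule image_cong) (auto simp: eq)
  also have "\<dots> = h ` products G X (Suc n)"
    by (simp add: image_image case_prod_beta)
  finally show ?case .
qed

text \<open>\<open>X\<close> is padded to exactly \<open>d\<close> elements. Words of length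
  \<open>k\<close> still reach everything, and \<open>big\<close> already speaks of
  \<open>d\<close>, so the diameter is exactly \<open>k\<close>. An injection into
  \<open>nat\<close> then makes the order a member of \<open>cayley_orders d k\<close>.\<close>

lemma (in group) order_le_cayley_number:
  assumes "finite (carrier G)" "X \<subseteq> carrier G" "\<one> \<notin> X"
    and all: "carrier G \<subseteq> products G X k"
    and "card X \<le> d" and big: "(\<Sum>n<k. d ^ n) < order G" and "k \<ge> 2"
  shows "order G \<le> cayley_number d k"
proof -
  \<comment> \<open>The exponents 0 and 1 alone give \<open>1 + d < order G\<close>, so there are
    enough non-identity elements for the padding.\<close>
  have "(\<Sum>n<2. d ^ n) \<le> (\<Sum>n<k. d ^ n)"
    using \<open>k \<ge> 2\<close> by (intro sum_mono2) auto
  with big have "d \<le> card (carrier G - {\<one>})"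
    using assms(1) by (simp add: order_def numeral_2_eq_2)
  then obtain Y where Y: "X \<subseteq> Y" "Y \<subseteq> carrier G - {\<one>}" "card Y = d"
    using exists_subset_between[of X d "carrier G - {\<one>}"] assms by auto
  obtain h :: "'a \<Rightarrow> nat" where h: "inj_on h (carrier G)"
    using finite_imp_inj_to_nat_seg[OF assms(1)] by blast
  let ?H = "image_group h G"
  interpret H: group ?H by (rule image_group_inj[OF h])
  have YG: "Y \<subseteq> carrier G" using Y by auto
  have all': "carrier ?H \<subseteq> products ?H (h ` Y) k"
    using all products_mono[OF Y(1), of G k]
    by (auto simp: products_image_group[OF h YG] image_group_carrier)
  have card: "card (h ` Y) = d"
    using Y(3) card_image inj_on_subset[OF h YG] by blast
  have ord: "order ?H = order G"
    by (simp add: order_def image_group_carrier card_image[OF h])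
  have sub: "h ` Y \<subseteq> carrier ?H"
    using YG by (auto simp: image_group_carrier)
  have fin: "finite (carrier ?H)"
    by (simp add: image_group_carrier assms(1))
  have "order ?H \<in> cayley_orders d k"
    unfolding cayley_orders_def
  proof (intro CollectI exI conjI)
    show "generate ?H (h ` Y) = carrier ?H"
      using H.generate_in_carrier[OF sub] all' H.products_in_generate by blast
    show "\<one>\<^bsub>?H\<^esub> \<notin> h ` Y"
      using Y(2) inj_onD[OF h] by (fastforce simp: image_group_one)
    show "digraph_diameter (cayley_digraph ?H (h ` Y)) = ereal (real k)"
      using H.digraph_diameter_eq[OF sub finite_subset[OF sub fin] all'] big
      by (simp add: card ord)
  qed (use fin sub card H.is_group in simp_all)
  then show ?thesis
    unfolding cayley_number_def using finite_cayley_orders ord by (metis Max_ge)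
qed

section \<open>The group of marked tapes\<close>

text \<open>The integer tape with 1 in the cell \<open>a\<close> and 0 elsewhere, cells being
  residue classes modulo \<open>k\<close>.\<close>

definition delta :: "int \<Rightarrow> int \<Rightarrow> int \<Rightarrow> int" where
  "delta k a c = of_bool (k dvd c - a)"

lemma delta_periodic: "delta k a (c + k) = delta k a c"
proof -
  have "c + k - a = c - a + k" by simp
  then show ?thesis by (simp only: delta_def dvd_add_triv_right_iff)
qed

lemma delta_cong:
  assumes "k dvd a - b"
  shows "delta k a = delta k b"
proof
  fix c
  show "delta k a c = delta k b c"
    using dvd_add_left_iff[OF assms, of "c - a"] by (simp add: delta_def)
qed

text \<open>The cell \<open>b\<close> as seen from the head \<open>(p, e)\<close> is the absolute
  cell \<open>p + e * b\<close>, because \<open>e\<close> is its own inverse; reducing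
  \<open>p\<close> only shifts arguments by multiples of \<open>k\<close>.\<close>

lemma delta_affine:
  assumes "e = 1 \<or> e = -1"
  shows "delta k b (e * (c - p mod k)) = delta k (p + e * b) c"
proof -
  obtain t where "p mod k = p - k * t" by (metis minus_mult_div_eq_mod)
  then have "e * (c - p mod k) - b = e * (c - (p + e * b)) + k * (e * t)"
    using assms by (auto simp: algebra_simps)
  then have "k dvd e * (c - p mod k) - b \<longleftrightarrow> k dvd e * (c - (p + e * b))"
    by (metis dvd_add_left_iff dvd_triv_left)
  also have "\<dots> \<longleftrightarrow> k dvd c - (p + e * b)"
    using assms by (auto simp: dvd_diff_commute)
  finally show ?thesis by (simp add: delta_def)
qed

lemma periodic_cong:
  fixes f :: "int \<Rightarrow> 'a"
  assumes per: "\<And>c. f (c + k) = f c" and "k dvd a - b"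
  shows "f a = f b"
proof -
  have nat: "f (c + k * int n) = f c" for c n
  proof (induction n)
    case (Suc n)
    have "f (c + k * int (Suc n)) = f (c + k * int n + k)" by (simp add: algebra_simps)
    with Suc per show ?case by simp
  qed simp
  obtain t where t: "a - b = k * t" using assms(2) by (rule dvdE)
  show ?thesis
  proof (cases "t \<ge> 0")
    case True
    then show ?thesis using nat[of b "nat t"] t by (simp add: algebra_simps)
  next
    case False
    then have "b = a + k * int (nat (- t))" using t by (simp add: algebra_simps)
    then show ?thesis using nat[of a "nat (- t)"] by simp
  qed
qed

lemma periodic_eq_sum_delta:
  assumes "k > 0" and per: "\<And>c. f (c + k) = f c"
  shows "f c = (\<Sum>a\<in>{0..<k}. f a * delta k a c)"
proof -
  have "(\<Sum>a\<in>{0..<k}. f a * delta k a c) = (\<Sum>a\<in>{0..<k}. if a = c mod k then f a else 0)"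
  proof (rule sum.cong)
    fix a assume "a \<in> {0..<k}"
    then have "k dvd c - a \<longleftrightarrow> a = c mod k"
      by (auto simp: mod_eq_dvd_iff[symmetric])
    then show "f a * delta k a c = (if a = c mod k then f a else 0)" by (simp add: delta_def)
  qed simp
  also have "\<dots> = f (c mod k)" using assms(1) by simp
  also have "\<dots> = f c" using per by (rule periodic_cong) (simp add: mod_eq_dvd_iff[symmetric])
  finally show ?thesis ..
qed

text \<open>The head \<open>(p, e)\<close> acts on tapes by the affine maps \<open>c \<mapsto> p + e * c\<close> modulo \<open>k\<close>. Tapes are
  periodic functions on \<open>int\<close> rather than functions on residues, so that cells can be
  addressed by integers that are not reduced.\<close>

definition dihedral_wreath :: "int \<Rightarrow> int \<Rightarrow> ((int \<Rightarrow> int) \<times> int \<times> int) monoid" where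
  "dihedral_wreath m k =
    \<lparr>carrier = {(f, p, e). (\<forall>c. f (c + k) = f c \<and> f c \<in> {0..<m}) \<and> p \<in> {0..<k} \<and> e \<in> {1, -1}},
     monoid.mult = (\<lambda>(f, p, e) (g, q, d). (\<lambda>c. (f c + g (e * (c - p))) mod m, (p + e * q) mod k, e * d)),
     monoid.one = (\<lambda>_. 0, 0, 1)\<rparr>"

lemma dihedral_wreath_simps:
  "\<one>\<^bsub>dihedral_wreath m k\<^esub> = (\<lambda>_. 0, 0, 1)"
  "(f, p, e) \<otimes>\<^bsub>dihedral_wreath m k\<^esub> (g, q, d) =
    (\<lambda>c. (f c + g (e * (c - p))) mod m, (p + e * q) mod k, e * d)"
  "(f, p, e) \<in> carrier (dihedral_wreath m k) \<longleftrightarrow>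
    (\<forall>c. f (c + k) = f c \<and> 0 \<le> f c \<and> f c < m) \<and> 0 \<le> p \<and> p < k \<and> (e = 1 \<or> e = -1)"
  by (auto simp: dihedral_wreath_def)

lemma group_dihedral_wreath:
  assumes "m > 0" "k > 0"
  shows "group (dihedral_wreath m k)"
proof (rule groupI)
  let ?G = "dihedral_wreath m k"
  fix x y z
  assume x: "x \<in> carrier ?G"
  obtain f p e where x_eq: "x = (f, p, e)" by (cases x)
  show "\<one>\<^bsub>?G\<^esub> \<otimes>\<^bsub>?G\<^esub> x = x"
    using x by (auto simp: x_eq dihedral_wreath_simps)
  have per_f: "f (c + k) = f c" and rng_f: "0 \<le> f c" "f c < m" for c
    using x by (auto simp: x_eq dihedral_wreath_simps)
  have e: "e = 1 \<or> e = -1" using x by (auto simp: x_eq dihedral_wreath_simps)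
  have shift: "g (d * (c + k - q)) = g (d * (c - q))"
    if per: "\<And>c. g (c + k) = g c" and "d = 1 \<or> d = -1" for g :: "int \<Rightarrow> int" and d c q
    using per by (rule periodic_cong) (use that(2) in \<open>auto simp: algebra_simps\<close>)
  show "\<exists>y\<in>carrier ?G. y \<otimes>\<^bsub>?G\<^esub> x = \<one>\<^bsub>?G\<^esub>"
  proof (rule bexI)
    \<comment> \<open>The inverse of the affine map \<open>c \<mapsto> p + e * c\<close> is
      \<open>c \<mapsto> - e * p + e * c\<close>; the tape cancels \<open>f\<close> as read from
      that head.\<close>
    let ?y = "(\<lambda>c. (- f (e * (c - (- e * p) mod k))) mod m, (- e * p) mod k, e)"
    show "?y \<in> carrier ?G"
      using e assms shift[of f e, OF per_f e] by (auto simp: dihedral_wreath_simps)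
    show "?y \<otimes>\<^bsub>?G\<^esub> x = \<one>\<^bsub>?G\<^esub>"
      using e by (auto simp: x_eq dihedral_wreath_simps mod_simps)
  qed
  assume y: "y \<in> carrier ?G"
  obtain g q d where y_eq: "y = (g, q, d)" by (cases y)
  have per_g: "g (c + k) = g c" and d: "d = 1 \<or> d = -1" for c
    using y by (auto simp: y_eq dihedral_wreath_simps)
  show "x \<otimes>\<^bsub>?G\<^esub> y \<in> carrier ?G"
    using x y assms shift[of g e, OF per_g e]
    by (auto simp: x_eq y_eq dihedral_wreath_simps)
  assume z: "z \<in> carrier ?G"
  obtain h r s where z_eq: "z = (h, r, s)" by (cases z)
  have per_h: "h (c + k) = h c" for c
    using z by (auto simp: z_eq dihedral_wreath_simps)
  \<comment> \<open>Associativity on tapes: reading \<open>h\<close> through the composite head or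
    through the two heads in turn gives arguments that agree modulo \<open>k\<close>.\<close>
  have "h (e * d * (c - (p + e * q) mod k)) = h (d * (e * (c - p) - q))" for c
    using per_h
  proof (rule periodic_cong)
    obtain t where t: "(p + e * q) mod k = p + e * q - k * t"
      by (metis minus_mult_div_eq_mod)
    have "e * d * (c - (p + e * q) mod k) - d * (e * (c - p) - q) = k * (e * d * t)"
      unfolding t using e by (auto simp: algebra_simps)
    then show "k dvd e * d * (c - (p + e * q) mod k) - d * (e * (c - p) - q)" by simp
  qed
  moreover have "((p + e * q) mod k + e * d * r) mod k = (p + e * ((q + d * r) mod k)) mod k"
    using e by (auto simp: mod_simps algebra_simps)
  ultimately show "x \<otimes>\<^bsub>?G\<^esub> y \<otimes>\<^bsub>?G\<^esub> z = x \<otimes>\<^bsub>?G\<^esub> (y \<otimes>\<^bsub>?G\<^esub> z)"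
    by (simp add: x_eq y_eq z_eq dihedral_wreath_simps fun_eq_iff mod_simps ac_simps)
next
  show "\<one>\<^bsub>dihedral_wreath m k\<^esub> \<in> carrier (dihedral_wreath m k)"
    using assms by (auto simp: dihedral_wreath_simps)
qed

text \<open>Restriction to one period identifies tapes with functions on \<open>k\<close> cells; the
  head contributes the factor \<open>2 * k\<close>.\<close>

lemma finite_order_dihedral_wreath:
  assumes "m > 0" "k > 0"
  shows "finite (carrier (dihedral_wreath m k))"
    and "order (dihedral_wreath m k) = 2 * nat k * nat m ^ nat k"
proof -
  let ?P = "{f :: int \<Rightarrow> int. \<forall>c. f (c + k) = f c \<and> f c \<in> {0..<m}}"
  have "bij_betw (\<lambda>f. restrict f {0..<k}) ?P ({0..<k} \<rightarrow>\<^sub>E {0..<m})"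
  proof (rule bij_betw_byWitness[where f' = "\<lambda>f c. f (c mod k)"])
    show "\<forall>f\<in>?P. (\<lambda>c. restrict f {0..<k} (c mod k)) = f"
    proof (intro ballI ext)
      fix f c assume "f \<in> ?P"
      then have "f (c + k) = f c" for c by simp
      then have "f (c mod k) = f c" by (rule periodic_cong) (simp add: mod_eq_dvd_iff[symmetric])
      then show "restrict f {0..<k} (c mod k) = f c" using assms by simp
    qed
    show "\<forall>f\<in>{0..<k} \<rightarrow>\<^sub>E {0..<m}. restrict (\<lambda>c. f (c mod k)) {0..<k} = f"
      by (auto simp: fun_eq_iff PiE_def extensional_def)
    show "(\<lambda>f. restrict f {0..<k}) ` ?P \<subseteq> {0..<k} \<rightarrow>\<^sub>E {0..<m}" by auto
    show "(\<lambda>f c. f (c mod k)) ` ({0..<k} \<rightarrow>\<^sub>E {0..<m}) \<subseteq> ?P"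
    proof (rule image_subsetI)
      fix f assume "f \<in> {0..<k} \<rightarrow>\<^sub>E {0..<m}"
      then have "f (c mod k) \<in> {0..<m}" for c
        using assms by (auto simp: PiE_iff)
      then show "(\<lambda>c. f (c mod k)) \<in> ?P" by simp
    qed
  qed
  note bij = bij_betw_finite[OF this] bij_betw_same_card[OF this]
  have P: "finite ?P" "card ?P = nat m ^ nat k"
    unfolding bij by (intro finite_PiE) (simp_all add: card_PiE)
  have eq: "carrier (dihedral_wreath m k) = ?P \<times> {0..<k} \<times> {1, -1}"
    by (auto simp: dihedral_wreath_def)
  show "finite (carrier (dihedral_wreath m k))" using P by (simp add: eq)
  show "order (dihedral_wreath m k) = 2 * nat k * nat m ^ nat k"
    by (simp only: order_def eq card_cartesian_product P) simp
qed

section \<open>Words and the cells they control\<close>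

datatype letter = Advance | Turn

text \<open>Positions stay unreduced integers, so that endpoints of words are linear expressions;
  reduction modulo \<open>k\<close> is left to the group.\<close>

primrec move :: "letter \<Rightarrow> int \<times> int \<Rightarrow> int \<times> int" where
  "move Advance s = (fst s + 4 * snd s, snd s)"
| "move Turn s = (fst s, - snd s)"

primrec endpoint :: "letter list \<Rightarrow> int \<times> int \<Rightarrow> int \<times> int" where
  "endpoint [] s = s"
| "endpoint (l # w) s = endpoint w (move l s)"

primrec imprint :: "int \<Rightarrow> letter \<Rightarrow> int \<times> int \<Rightarrow> int \<Rightarrow> int" where
  "imprint k Advance s = delta k (fst s + 3 * snd s)"
| "imprint k Turn s = (\<lambda>c. delta k (fst s + snd s) c + delta k (fst s + 3 * snd s) c)"

text \<open>Coefficients range over all integers, which makes the set closed under integer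
  combinations; \<open>m\<close> enters only when a word is evaluated in the group.\<close>

primrec imprints :: "int \<Rightarrow> letter list \<Rightarrow> int \<times> int \<Rightarrow> (int \<Rightarrow> int) set" where
  "imprints k [] s = {\<lambda>_. 0}"
| "imprints k (l # w) s =
    {\<lambda>c. g * imprint k l s c + f c | g f. f \<in> imprints k w (move l s)}"

definition generator :: "int \<Rightarrow> int \<Rightarrow> int \<Rightarrow> letter \<Rightarrow> (int \<Rightarrow> int) \<times> int \<times> int" where
  "generator m k g l = (\<lambda>c. (g * imprint k l (0, 1) c) mod m,
    case l of Advance \<Rightarrow> (4 mod k, 1) | Turn \<Rightarrow> (0, -1))"

definition generators :: "int \<Rightarrow> int \<Rightarrow> ((int \<Rightarrow> int) \<times> int \<times> int) set" where
  "generators m k = (\<lambda>(g, l). generator m k g l) ` ({0..<m} \<times> {Advance, Turn})"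

lemma imprint_periodic: "imprint k l s (c + k) = imprint k l s c"
  by (cases l) (simp_all add: delta_periodic)

lemma generators_subset:
  assumes "m > 0" "k > 0"
  shows "generators m k \<subseteq> carrier (dihedral_wreath m k)"
  using assms
  by (auto simp: generators_def generator_def dihedral_wreath_simps imprint_periodic delta_periodic
      split: letter.split)

lemma card_generators_le: "card (generators m k) \<le> 2 * nat m"
proof -
  have "card (generators m k) \<le> card ({0..<m} \<times> {Advance, Turn})"
    unfolding generators_def by (rule card_image_le) simp
  also have "\<dots> = 2 * nat m" by (simp add: card_cartesian_product)
  finally show ?thesis .
qed

text \<open>A turn reverses the direction, and an advance moves the head by 4, which is trivial only
  if \<open>k\<close> divides 4.\<close>

lemma one_notin_generators:
  assumes "\<not> k dvd 4"
  shows "\<one>\<^bsub>dihedral_wreath m k\<^esub> \<notin> generators m k"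
  using assms
  by (auto simp: generators_def generator_def dihedral_wreath_simps dvd_eq_mod_eq_0
      split: letter.split)

text \<open>Right multiplication by a generator performs its letter relative to the current
  head.\<close>

lemma imprint_affine:
  assumes "e = 1 \<or> e = -1"
  shows "imprint k l (0, 1) (e * (c - p mod k)) = imprint k l (p, e) c"
  using delta_affine[OF assms, of k _ c p] by (cases l) (simp_all add: mult.commute)

text \<open>The starting element is arbitrary so that the induction can continue from the state
  after the first letter.\<close>

lemma imprints_reachable:
  assumes "m > 0" "k > 0"
  shows "\<lbrakk>F \<in> imprints k w (p, e); (f, p mod k, e) \<in> carrier (dihedral_wreath m k)\<rbrakk> \<Longrightarrow>
    \<exists>x\<in>products (dihedral_wreath m k) (generators m k) (length w).
      (f, p mod k, e) \<otimes>\<^bsub>dihedral_wreath m k\<^esub> x =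
        (\<lambda>c. (f c + F c) mod m, fst (endpoint w (p, e)) mod k, snd (endpoint w (p, e)))"
proof (induction w arbitrary: F p e f)
  case Nil
  then show ?case by (auto simp: dihedral_wreath_simps)
next
  case (Cons l w)
  let ?G = "dihedral_wreath m k"
  interpret group ?G by (rule group_dihedral_wreath[OF assms])
  obtain g F' where F: "F = (\<lambda>c. g * imprint k l (p, e) c + F' c)"
    and F': "F' \<in> imprints k w (move l (p, e))"
    using Cons.prems(1) by auto
  obtain p' e' where pe': "move l (p, e) = (p', e')" by fastforce
  have e: "e = 1 \<or> e = -1" using Cons.prems(2) by (auto simp: dihedral_wreath_simps)
  \<comment> \<open>The integer coefficient \<open>g\<close> is reduced modulo \<open>m\<close> to
    select one of the finitely many generators.\<close>
  define y where "y = generator m k (g mod m) l"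
  have y: "y \<in> generators m k"
    using assms unfolding y_def generators_def
    by (intro image_eqI[of _ _ "(g mod m, l)"]) (cases l; simp)+
  define f' where "f' = (\<lambda>c. (f c + g * imprint k l (p, e) c) mod m)"
  have xy: "(f, p mod k, e) \<otimes>\<^bsub>?G\<^esub> y = (f', p' mod k, e')"
    using pe' imprint_affine[OF e, of k l _ p]
    using e by (cases l) (auto simp: y_def generator_def dihedral_wreath_simps f'_def mod_simps
        simp del: imprint.simps)
  have in_y: "y \<in> carrier ?G" using y generators_subset[OF assms] by auto
  with xy Cons.prems(2) have "(f', p' mod k, e') \<in> carrier ?G"
    by (metis m_closed)
  from Cons.IH[OF F'[unfolded pe'] this] obtain x
    where x: "x \<in> products ?G (generators m k) (length w)"
      "(f', p' mod k, e') \<otimes>\<^bsub>?G\<^esub> x = (\<lambda>c. (f' c + F' c) mod m,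
        fst (endpoint w (p', e')) mod k, snd (endpoint w (p', e')))"
    by blast
  have "(f, p mod k, e) \<otimes>\<^bsub>?G\<^esub> (y \<otimes>\<^bsub>?G\<^esub> x) = (f', p' mod k, e') \<otimes>\<^bsub>?G\<^esub> x"
    using x(1) in_y Cons.prems(2) products_in_carrier[OF generators_subset[OF assms]]
    by (subst m_assoc[symmetric]) (auto simp: xy)
  also have "\<dots> = (\<lambda>c. (f c + F c) mod m,
        fst (endpoint (l # w) (p, e)) mod k, snd (endpoint (l # w) (p, e)))"
    unfolding x(2) using pe' by (simp add: f'_def F mod_simps add.assoc)
  finally show ?case using x(1) y by (intro bexI[of _ "y \<otimes>\<^bsub>?G\<^esub> x"]) auto
qed

section \<open>Integer combinations of imprints\<close>

lemma zero_in_imprints: "(\<lambda>_. 0) \<in> imprints k w s"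
proof (induction w arbitrary: s)
  case (Cons l w)
  from Cons.IH[of "move l s"] show ?case by (auto intro!: exI[of _ 0])
qed simp

lemma imprints_add:
  "F \<in> imprints k w s \<Longrightarrow> F' \<in> imprints k w s \<Longrightarrow> (\<lambda>c. F c + F' c) \<in> imprints k w s"
proof (induction w arbitrary: s F F')
  case (Cons l w)
  then obtain g f g' f' where "F = (\<lambda>c. g * imprint k l s c + f c)" "f \<in> imprints k w (move l s)"
    "F' = (\<lambda>c. g' * imprint k l s c + f' c)" "f' \<in> imprints k w (move l s)" by auto
  then show ?case
    using Cons.IH[of f "move l s" f']
    by (auto intro!: exI[of _ "g + g'"] exI[of _ "\<lambda>c. f c + f' c"] simp: algebra_simps)
qed simp

lemma imprints_scale: "F \<in> imprints k w s \<Longrightarrow> (\<lambda>c. a * F c) \<in> imprints k w s"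
proof (induction w arbitrary: s F)
  case (Cons l w)
  then obtain g f where "F = (\<lambda>c. g * imprint k l s c + f c)" "f \<in> imprints k w (move l s)"
    by auto
  then show ?case
    using Cons.IH[of f "move l s"]
    by (auto intro!: exI[of _ "a * g"] exI[of _ "\<lambda>c. a * f c"] simp: algebra_simps)
qed simp

lemma imprints_sum:
  "(\<And>i. i \<in> I \<Longrightarrow> F i \<in> imprints k w s) \<Longrightarrow> (\<lambda>c. \<Sum>i\<in>I. F i c) \<in> imprints k w s"
  by (induction I rule: infinite_finite_induct) (auto simp: zero_in_imprints intro: imprints_add)

lemma endpoint_append: "endpoint (u @ v) s = endpoint v (endpoint u s)"
  by (induction u arbitrary: s) simp_all

lemma imprints_append_left: "F \<in> imprints k u s \<Longrightarrow> F \<in> imprints k (u @ v) s"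
proof (induction u arbitrary: s F)
  case (Cons l u)
  from Cons.prems obtain g f where "F = (\<lambda>c. g * imprint k l s c + f c)"
    "f \<in> imprints k u (move l s)" by auto
  with Cons.IH[of f "move l s"] show ?case by auto
qed (simp add: zero_in_imprints)

lemma imprints_append_right: "F \<in> imprints k v (endpoint u s) \<Longrightarrow> F \<in> imprints k (u @ v) s"
proof (induction u arbitrary: s)
  case (Cons l u)
  from Cons.IH[of "move l s"] Cons.prems show ?case by (auto intro!: exI[of _ 0])
qed simp

definition covers :: "int \<Rightarrow> letter list \<Rightarrow> int \<times> int \<Rightarrow> int \<Rightarrow> bool" where
  "covers k w s c \<longleftrightarrow> delta k c \<in> imprints k w s"

definition links :: "int \<Rightarrow> letter list \<Rightarrow> int \<times> int \<Rightarrow> int \<Rightarrow> int \<Rightarrow> bool" where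
  "links k w s a b \<longleftrightarrow> (\<lambda>c. delta k a c + delta k b c) \<in> imprints k w s"

lemma covers_append:
  "covers k u s c \<Longrightarrow> covers k (u @ v) s c"
  "covers k v (endpoint u s) c \<Longrightarrow> covers k (u @ v) s c"
  unfolding covers_def by (fact imprints_append_left, fact imprints_append_right)

lemma links_append:
  "links k u s a b \<Longrightarrow> links k (u @ v) s a b"
  "links k v (endpoint u s) a b \<Longrightarrow> links k (u @ v) s a b"
  unfolding links_def by (fact imprints_append_left, fact imprints_append_right)

lemma covers_cong: "k dvd a - b \<Longrightarrow> covers k w s a \<longleftrightarrow> covers k w s b"
  by (simp add: covers_def delta_cong)

text \<open>Subtracting one single-cell tape from the sum of both leaves the other.\<close>

lemma links_covers:
  assumes "links k w s a b"
  shows "covers k w s a \<longleftrightarrow> covers k w s b"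
proof -
  have "covers k w s b" if "covers k w s a" "links k w s a b" for a b
    using imprints_add[OF that(2)[unfolded links_def] imprints_scale[OF that(1)[unfolded covers_def], of "-1"]]
    by (simp add: covers_def)
  moreover have "links k w s b a" using assms by (simp add: links_def add.commute)
  ultimately show ?thesis using assms by blast
qed

text \<open>Single-cell tapes span all tapes over the integers, so \<open>f\<close> itself lies in
  \<open>imprints k w (0, 1)\<close>; running \<open>w\<close> from the identity then writes
  it.\<close>

lemma reachable_if_covers:
  assumes "m > 0" "k > 0" and all: "\<And>c. covers k w (0, 1) c"
    and t: "(f, p, e) \<in> carrier (dihedral_wreath m k)"
    and p: "k dvd fst (endpoint w (0, 1)) - p" and e: "snd (endpoint w (0, 1)) = e"
  shows "(f, p, e) \<in> products (dihedral_wreath m k) (generators m k) (length w)"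
proof -
  let ?G = "dihedral_wreath m k"
  interpret group ?G by (rule group_dihedral_wreath[OF assms(1,2)])
  have per: "f (c + k) = f c" and rng: "0 \<le> f c" "f c < m" for c
    using t by (auto simp: dihedral_wreath_simps)
  have "(\<lambda>c. \<Sum>a\<in>{0..<k}. f a * delta k a c) \<in> imprints k w (0, 1)"
    using all by (intro imprints_sum imprints_scale) (simp add: covers_def)
  moreover have "f = (\<lambda>c. \<Sum>a\<in>{0..<k}. f a * delta k a c)"
    by (rule ext) (rule periodic_eq_sum_delta[of k f, OF assms(2) per])
  ultimately have "f \<in> imprints k w (0, 1)" by simp
  moreover have "(\<lambda>_. 0, 0 mod k, 1) \<in> carrier ?G"
    using assms(1,2) by (auto simp: dihedral_wreath_simps)
  ultimately obtain x where x: "x \<in> products ?G (generators m k) (length w)"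
    "\<one>\<^bsub>?G\<^esub> \<otimes>\<^bsub>?G\<^esub> x = (\<lambda>c. (0 + f c) mod m, fst (endpoint w (0, 1)) mod k, snd (endpoint w (0, 1)))"
    using imprints_reachable[OF assms(1,2), of f w 0 1 "\<lambda>_. 0"] by (auto simp: dihedral_wreath_simps(1))
  have "fst (endpoint w (0, 1)) mod k = p"
    using p t by (simp add: mod_eq_dvd_iff[symmetric] dihedral_wreath_simps)
  then have "\<one>\<^bsub>?G\<^esub> \<otimes>\<^bsub>?G\<^esub> x = (f, p, e)" using x(2) rng e by simp
  moreover have "x \<in> carrier ?G"
    using x(1) products_in_carrier[OF generators_subset[OF assms(1,2)]] by blast
  ultimately show ?thesis using x(1) by simp
qed

section \<open>Straight runs, zigzags and indices of cells\<close>

definition straight :: "nat \<Rightarrow> letter list" where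
  "straight n = replicate n Advance"

text \<open>The two turns cancel, so a block moves the head by 8. Its four letters control the four
  cells at offsets 1, 3, 5, 7; with \<open>k\<close> letters for \<open>k\<close> cells, none can be
  spared.\<close>

definition zigzag :: "nat \<Rightarrow> letter list" where
  "zigzag n = concat (replicate n [Advance, Turn, Turn, Advance])"

lemma length_straight: "length (straight n) = n"
  by (simp add: straight_def)

lemma length_zigzag: "length (zigzag n) = 4 * n"
  by (induction n) (simp_all add: zigzag_def)

lemma endpoint_straight: "endpoint (straight n) (p, e) = (p + 4 * int n * e, e)"
  by (induction n arbitrary: p) (simp_all add: straight_def algebra_simps)

lemma endpoint_zigzag: "endpoint (zigzag n) (p, e) = (p + 8 * int n * e, e)"
  by (induction n arbitrary: p) (simp_all add: zigzag_def algebra_simps)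

lemmas endpoints = endpoint_append endpoint_straight endpoint_zigzag

lemma covers_Advance: "covers k (Advance # w) (p, e) (p + 3 * e)"
  using zero_in_imprints[of k w "(p + 4 * e, e)"]
  by (auto simp: covers_def intro!: exI[of _ 1] exI[of _ "\<lambda>_. 0"])

lemma links_Turn: "links k (Turn # w) (p, e) (p + e) (p + 3 * e)"
  using zero_in_imprints[of k w "(p, - e)"]
  by (auto simp: links_def intro!: exI[of _ 1] exI[of _ "\<lambda>_. 0"])

lemma covers_straight: "i < n \<Longrightarrow> covers k (straight n) (p, e) (p + (4 * int i + 3) * e)"
proof (induction n arbitrary: p i)
  case (Suc n)
  have eq: "straight (Suc n) = [Advance] @ straight n" by (simp add: straight_def)
  show ?case
  proof (cases i)
    case 0
    then show ?thesis
      using covers_Advance[of k "straight n" p e] by (simp add: eq)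
  next
    case (Suc i')
    then have "covers k (straight n) (p + 4 * e, e) (p + 4 * e + (4 * int i' + 3) * e)"
      using Suc.IH Suc.prems by simp
    then show ?thesis
      unfolding eq by (intro covers_append(2)) (simp add: Suc algebra_simps)
  qed
qed simp

text \<open>Both turns of a block happen at the same head position, once in each direction: they link the
  cells behind and ahead of the head to those written by the two advances.\<close>

lemma covers_zigzag: "i < 4 * n \<Longrightarrow> covers k (zigzag n) (p, e) (p + (2 * int i + 1) * e)"
proof (induction n arbitrary: p i)
  case (Suc n)
  have eq: "zigzag (Suc n) = [Advance, Turn, Turn, Advance] @ zigzag n"
    by (simp add: zigzag_def)
  let ?B = "[Advance, Turn, Turn, Advance]"
  show ?case
  proof (cases "i < 4")
    case True
    have 1: "covers k ?B (p, e) (p + 3 * e)"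
      by (rule covers_Advance)
    have 3: "covers k ?B (p, e) (p + 7 * e)"
      using covers_append(2)[of k "[Advance]" "[Advance, Turn, Turn]" "(p, e)"]
        covers_Advance[of k "[]" "p + 4 * e" e] by (simp add: algebra_simps)
    have 2: "links k ?B (p, e) (p + 5 * e) (p + 7 * e)"
      using links_append(2)[of k "[Turn, Turn, Advance]" "[Advance]" "(p, e)"]
        links_Turn[of k "[Turn, Advance]" "p + 4 * e" e] by (simp add: algebra_simps)
    have 4: "links k ?B (p, e) (p + 3 * e) (p + e)"
      using links_append(2)[of k "[Turn, Advance]" "[Advance, Turn]" "(p, e)"]
        links_Turn[of k "[Advance]" "p + 4 * e" "- e"] by (simp add: algebra_simps)
    have "i = 0 \<or> i = 1 \<or> i = 2 \<or> i = 3" using True by linarith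
    then have "covers k ?B (p, e) (p + (2 * int i + 1) * e)"
      using 1 3 links_covers[OF 2] links_covers[OF 4] by (auto simp: algebra_simps)
    then show ?thesis unfolding eq by (rule covers_append(1))
  next
    case False
    then obtain i' where i: "i = i' + 4" by (metis add.commute le_Suc_ex not_less)
    then have "covers k (zigzag n) (p + 8 * e, e) (p + 8 * e + (2 * int i' + 1) * e)"
      using Suc.IH Suc.prems by simp
    then show ?thesis
      unfolding eq by (intro covers_append(2)) (simp add: i algebra_simps)
  qed
qed simp

text \<open>Centring the arithmetic on the head forces cells at odd distance from it; \<open>x\<close> indexes the cell
  \<open>2 * x + 1\<close>, so that consecutive indices denote the two cells joined by a turn.\<close>

definition covers_index :: "int \<Rightarrow> letter list \<Rightarrow> int \<times> int \<Rightarrow> int \<Rightarrow> bool" where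
  "covers_index k w s x \<longleftrightarrow> covers k w s (2 * x + 1)"

lemma covers_index_cong: "k dvd x - y \<Longrightarrow> covers_index k w s x \<longleftrightarrow> covers_index k w s y"
proof -
  assume "k dvd x - y"
  then have "k dvd 2 * (x - y)" by (rule dvd_mult)
  then show ?thesis unfolding covers_index_def by (intro covers_cong) (simp add: algebra_simps)
qed

text \<open>The advances write the indices \<open>q + 1\<close>, \<open>q + 3\<close>, ...,
  \<open>q + 2 * n - 1\<close>.\<close>

lemma covers_index_straight:
  assumes "endpoint u s = (2 * q, 1)" "q < x" "x < q + 2 * int n" "odd (x - q)"
    "w = u @ straight n @ v"
  shows "covers_index k w s x"
proof -
  obtain y where "x - q = 2 * y + 1" using assms(4) by (rule oddE)
  then have "covers k (straight n) (2 * q, 1) (2 * x + 1)"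
    using covers_straight[of "nat y" n k "2 * q" 1] assms(2,3) by (simp add: algebra_simps)
  then show ?thesis unfolding covers_index_def assms(5) using assms(1) by (intro covers_append) simp
qed

text \<open>Backward, the indices are \<open>q - 2\<close>, \<open>q - 4\<close>, ...,
  \<open>q - 2 * n\<close>. The parity relative to \<open>q\<close> has changed, which is why a run
  back complements a run forward.\<close>

lemma covers_index_straight':
  assumes "endpoint u s = (2 * q, -1)" "q - 2 * int n \<le> x" "x < q" "even (x - q)"
    "w = u @ straight n @ v"
  shows "covers_index k w s x"
proof -
  obtain y where "x - q = 2 * y" using assms(4) by (rule evenE)
  then have "covers k (straight n) (2 * q, -1) (2 * x + 1)"
    using covers_straight[of "nat (- y - 1)" n k "2 * q" "-1"] assms(2,3)
    by (simp add: algebra_simps)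
  then show ?thesis unfolding covers_index_def assms(5) using assms(1) by (intro covers_append) simp
qed

lemma covers_index_zigzag:
  assumes "endpoint u s = (2 * q, 1)" "q \<le> x" "x < q + 4 * int n"
    "w = u @ zigzag n @ v"
  shows "covers_index k w s x"
proof -
  have "covers k (zigzag n) (2 * q, 1) (2 * x + 1)"
    using covers_zigzag[of "nat (x - q)" n k "2 * q" 1] assms(2,3) by (simp add: algebra_simps)
  then show ?thesis unfolding covers_index_def assms(4) using assms(1) by (intro covers_append) simp
qed

lemma covers_index_zigzag':
  assumes "endpoint u s = (2 * q, -1)" "q - 4 * int n \<le> x" "x < q"
    "w = u @ zigzag n @ v"
  shows "covers_index k w s x"
proof -
  have "covers k (zigzag n) (2 * q, -1) (2 * x + 1)"
    using covers_zigzag[of "nat (q - x - 1)" n k "2 * q" "-1"] assms(2,3)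
    by (simp add: algebra_simps)
  then show ?thesis unfolding covers_index_def assms(4) using assms(1) by (intro covers_append) simp
qed

lemma covers_index_Turn:
  assumes "endpoint u s = (2 * q, 1)" "w = u @ [Turn] @ v" "x = q" "y = q + 1"
  shows "covers_index k w s x \<longleftrightarrow> covers_index k w s y"
  using links_covers[OF links_append(2)[of k "Turn # v" u s "2 * q + 1" "2 * q + 3"]]
    links_Turn[of k v "2 * q" 1] assms(1)
  unfolding assms(2-4) by (simp add: covers_index_def algebra_simps)

lemma covers_index_Turn':
  assumes "endpoint u s = (2 * q, -1)" "w = u @ [Turn] @ v" "x = q - 1" "y = q - 2"
  shows "covers_index k w s x \<longleftrightarrow> covers_index k w s y"
  using links_covers[OF links_append(2)[of k "Turn # v" u s "2 * q - 1" "2 * q - 3"]]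
    links_Turn[of k v "2 * q" "-1"] assms(1)
  unfolding assms(2-4) by (simp add: covers_index_def algebra_simps)

lemma covers_if_covers_index:
  assumes "k > 0" "odd k" and all: "\<And>x. \<lbrakk>l \<le> x; x < l + k\<rbrakk> \<Longrightarrow> covers_index k w s x"
  shows "covers k w s c"
proof -
  obtain h where h: "k = 2 * h + 1" using assms(2) by (rule oddE)
  \<comment> \<open>\<open>h + 1\<close> is the inverse of 2 modulo \<open>k\<close>, so
    \<open>(c - 1) * (h + 1)\<close> solves \<open>2 * x + 1 = c\<close> modulo \<open>k\<close>;
    the rest moves it into the window starting at \<open>l\<close>.\<close>
  define x where "x = l + ((c - 1) * (h + 1) - l) mod k"
  obtain t where "((c - 1) * (h + 1) - l) mod k = (c - 1) * (h + 1) - l - k * t"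
    by (metis minus_mult_div_eq_mod)
  then have "2 * x + 1 - c = k * (c - 1 - 2 * t)"
    by (simp add: x_def h algebra_simps)
  moreover have "covers_index k w s x"
    using assms(1) by (intro all) (simp_all add: x_def)
  ultimately show ?thesis
    using covers_cong[of k "2 * x + 1" c w s] by (simp add: covers_index_def)
qed

text \<open>Eight families follow, according to the final direction, the sign of the displacement (in units
  of 4, modulo \<open>k\<close>) and the parity of its absolute value. A straight run covers the odd indices on
  its way forward and the even ones on its way back, or on a second lap around the odd cycle;
  each index missed by the runs is tied to a covered one by a turn.\<close>

definition covering_word :: "int \<Rightarrow> int \<Rightarrow> int \<Rightarrow> letter list \<Rightarrow> bool" where
  "covering_word k p e w \<longleftrightarrow> int (length w) = k \<and> k dvd fst (endpoint w (0, 1)) - p \<and>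
    snd (endpoint w (0, 1)) = e \<and> (\<forall>c. covers k w (0, 1) c)"

text \<open>The zigzag fills \<open>0\<close> to \<open>4 * j - 1\<close>, the run out and back
  everything beyond except \<open>k - 1\<close>, which the turn ties to \<open>k\<close>, that is,
  to \<open>0\<close>. For \<open>j = 0\<close> the run back writes \<open>0\<close>, as
  \<open>k > 1\<close> forces \<open>a > 0\<close>.\<close>

lemma covering_word_even_forward_flip:
  assumes k: "k = 4 * int j + 2 * int a + 1" and "k > 1"
  shows "covering_word k (8 * int j) (-1)
    (zigzag j @ straight a @ [Turn] @ straight a)"
    (is "covering_word _ _ _ ?w")
proof -
  define R where "R = covers_index k ?w (0, 1)"
  have periodic: "R (x + k) \<longleftrightarrow> R x" for x
    unfolding R_def by (rule covers_index_cong) simp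
  have 1: "R x" if "0 \<le> x" "x < 4 * int j" for x
    unfolding R_def
    by (rule covers_index_zigzag[where u = "[]"
      and q = 0 and n = j and v = "straight a @ [Turn] @ straight a"])
      (use that in \<open>simp_all add: endpoints\<close>)
  have 2: "R x" if "4 * int j < x" "x < 4 * int j + 2 * int a" "odd x" for x
    unfolding R_def
    by (rule covers_index_straight[where u = "zigzag j"
      and q = "4 * int j" and n = a and v = "[Turn] @ straight a"])
      (use that in \<open>simp_all add: endpoints\<close>)
  have 3: "R (4 * int j + 2 * int a) \<longleftrightarrow> R (4 * int j + 2 * int a + 1)"
    unfolding R_def
    by (rule covers_index_Turn[where u = "zigzag j @ straight a"
      and q = "4 * int j + 2 * int a" and v = "straight a"]) (simp_all add: endpoints)
  have 4: "R x" if "4 * int j \<le> x" "x < 4 * int j + 2 * int a" "even x" for x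
    unfolding R_def
    by (rule covers_index_straight'[where u = "zigzag j @ straight a @ [Turn]"
      and q = "4 * int j + 2 * int a" and n = a and v = "[]"])
      (use that in \<open>simp_all add: endpoints\<close>)
  have "covers k ?w (0, 1) c" for c
  proof (rule covers_if_covers_index)
    fix x assume x: "0 \<le> x" "x < 0 + k"
    have "R 0" using 1[of 0] 4[of 0] \<open>k > 1\<close> by (cases "j = 0") (simp_all add: k)
    with 3 periodic[of 0] have last: "R (4 * int j + 2 * int a)" by (simp add: k)
    consider "x < 4 * int j" | "x = 4 * int j + 2 * int a"
      | "odd x" "4 * int j < x" "x < 4 * int j + 2 * int a"
      | "even x" "4 * int j \<le> x" "x < 4 * int j + 2 * int a"
      by atomize_elim (use x k in presburger)
    then have "R x"
      using last 1[of x] 2[of x] 4[of x] x by cases (simp_all add: k)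
    then show "covers_index k ?w (0, 1) x" by (simp add: R_def)
  qed (use assms in simp_all)
  moreover have "k dvd fst (endpoint ?w (0, 1)) - (8 * int j)"
    by (simp add: endpoints k)
  ultimately show ?thesis
    unfolding covering_word_def by (auto simp: endpoints k length_straight length_zigzag)
qed

text \<open>The run out and back comes first, then the zigzag extends the interval to the left. The
  turn ties the missing index \<open>2 * a\<close> to the far left end \<open>- 4 * j\<close>, one
  period below \<open>2 * a + 1\<close>.\<close>

lemma covering_word_even_backward_flip:
  assumes k: "k = 4 * int j + 2 * int a + 1" and "k > 1"
  shows "covering_word k (- 8 * int j) (-1)
    (straight a @ [Turn] @ straight a @ zigzag j)"
    (is "covering_word _ _ _ ?w")
proof -
  define R where "R = covers_index k ?w (0, 1)"
  have periodic: "R (x + k) \<longleftrightarrow> R x" for x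
    unfolding R_def by (rule covers_index_cong) simp
  have 1: "R x" if "0 < x" "x < 2 * int a" "odd x" for x
    unfolding R_def
    by (rule covers_index_straight[where u = "[]"
      and q = 0 and n = a and v = "[Turn] @ straight a @ zigzag j"])
      (use that in \<open>simp_all add: endpoints\<close>)
  have 2: "R (2 * int a) \<longleftrightarrow> R (2 * int a + 1)"
    unfolding R_def
    by (rule covers_index_Turn[where u = "straight a"
      and q = "2 * int a" and v = "straight a @ zigzag j"]) (simp_all add: endpoints)
  have 3: "R x" if "0 \<le> x" "x < 2 * int a" "even x" for x
    unfolding R_def
    by (rule covers_index_straight'[where u = "straight a @ [Turn]"
      and q = "2 * int a" and n = a and v = "zigzag j"])
      (use that in \<open>simp_all add: endpoints\<close>)
  have 4: "R x" if "- 4 * int j \<le> x" "x < 0" for x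
    unfolding R_def
    by (rule covers_index_zigzag'[where u = "straight a @ [Turn] @ straight a"
      and q = 0 and n = j and v = "[]"])
      (use that in \<open>simp_all add: endpoints\<close>)
  have "covers k ?w (0, 1) c" for c
  proof (rule covers_if_covers_index)
    fix x assume x: "- 4 * int j \<le> x" "x < - 4 * int j + k"
    have "R (- 4 * int j)"
      using 3[of "- 4 * int j"] 4[of "- 4 * int j"] \<open>k > 1\<close> by (cases "j = 0") (simp_all add: k)
    with 2 periodic[of "- 4 * int j"] have last: "R (2 * int a)" by (simp add: k)
    consider "x < 0" | "x = 2 * int a" | "odd x" "0 < x" "x < 2 * int a"
      | "even x" "0 \<le> x" "x < 2 * int a"
      by atomize_elim (use x k in presburger)
    then have "R x"
      using last 1[of x] 3[of x] 4[of x] x by cases (simp_all add: k)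
    then show "covers_index k ?w (0, 1) x" by (simp add: R_def)
  qed (use assms in simp_all)
  moreover have "k dvd fst (endpoint ?w (0, 1)) - (- 8 * int j)"
    by (simp add: endpoints k)
  ultimately show ?thesis
    unfolding covering_word_def by (auto simp: endpoints k length_straight length_zigzag)
qed

text \<open>After the turn all motion is backward. As \<open>k\<close> is odd, the second run,
  shifted by \<open>k\<close>, fills the odd indices between the even ones of the first. The turn
  ties the missing \<open>0\<close> to \<open>1\<close>, equivalently to
  \<open>1 - k\<close>.\<close>

lemma covering_word_odd_forward_flip:
  assumes k: "k = 4 * int j + 2 * int a + 3"
  shows "covering_word k (8 * int j + 4) (-1)
    ([Turn] @ straight (a + 1) @ zigzag j @ straight (a + 1))"
    (is "covering_word _ _ _ ?w")
proof -
  define R where "R = covers_index k ?w (0, 1)"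
  have periodic: "R (x + k) \<longleftrightarrow> R x" for x
    unfolding R_def by (rule covers_index_cong) simp
  have 1: "R 0 \<longleftrightarrow> R 1"
    unfolding R_def
    by (rule covers_index_Turn[where u = "[]"
      and q = 0 and v = "straight (a + 1) @ zigzag j @ straight (a + 1)"]) (simp_all add: endpoints)
  have 2: "R x" if "- 2 * int a - 2 \<le> x" "x < 0" "even x" for x
    unfolding R_def
    by (rule covers_index_straight'[where u = "[Turn]"
      and q = 0 and n = "a + 1" and v = "zigzag j @ straight (a + 1)"])
      (use that in \<open>simp_all add: endpoints\<close>)
  have 3: "R x" if "- 4 * int j - 2 * int a - 2 \<le> x" "x < - 2 * int a - 2" for x
    unfolding R_def
    by (rule covers_index_zigzag'[where u = "[Turn] @ straight (a + 1)"
      and q = "- 2 * int a - 2" and n = j and v = "straight (a + 1)"])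
      (use that in \<open>simp_all add: endpoints\<close>)
  have 4: "R x" if "- 4 * int j - 4 * int a - 4 \<le> x" "x < - 4 * int j - 2 * int a - 2" "even x" for x
    unfolding R_def
    by (rule covers_index_straight'[where u = "[Turn] @ straight (a + 1) @ zigzag j"
      and q = "- 4 * int j - 2 * int a - 2" and n = "a + 1" and v = "[]"])
      (use that in \<open>simp_all add: endpoints\<close>)
  have "covers k ?w (0, 1) c" for c
  proof (rule covers_if_covers_index)
    fix x assume x: "- k + 1 \<le> x" "x < - k + 1 + k"
    have "R (1 - k)"
      using 2[of "1 - k"] 3[of "1 - k"] by (cases "j = 0") (simp_all add: k)
    with 1 periodic[of "1 - k"] have zero: "R 0" by simp
    consider "x = 0" | "x < 0" "even x" "- 2 * int a - 2 \<le> x"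
      | "odd x" "- 2 * int a - 1 \<le> x" | "x < - 2 * int a - 2"
      by atomize_elim (use x in presburger)
    then have "R x"
      using zero 2[of x] 3[of x] 4[of "x - k"] periodic[of "x - k"] x by cases (simp_all add: k)
    then show "covers_index k ?w (0, 1) x" by (simp add: R_def)
  qed (use assms in simp_all)
  moreover have "k dvd fst (endpoint ?w (0, 1)) - (8 * int j + 4)"
    by (rule dvdI[of _ _ "- 4"]) (simp add: endpoints k)
  ultimately show ?thesis
    unfolding covering_word_def by (auto simp: endpoints k length_straight length_zigzag)
qed

text \<open>The second lap fills the even gaps of the first run except \<open>2 * a + 2\<close>; the
  final turn ties that one to \<open>2 * a + 1\<close>.\<close>

lemma covering_word_odd_backward_flip:
  assumes k: "k = 4 * int j + 2 * int a + 3"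
  shows "covering_word k (- 8 * int j - 4) (-1)
    (straight (a + 2) @ zigzag j @ straight a @ [Turn])"
    (is "covering_word _ _ _ ?w")
proof -
  define R where "R = covers_index k ?w (0, 1)"
  have periodic: "R (x + k) \<longleftrightarrow> R x" for x
    unfolding R_def by (rule covers_index_cong) simp
  have 1: "R x" if "0 < x" "x < 2 * int a + 4" "odd x" for x
    unfolding R_def
    by (rule covers_index_straight[where u = "[]"
      and q = 0 and n = "a + 2" and v = "zigzag j @ straight a @ [Turn]"])
      (use that in \<open>simp_all add: endpoints\<close>)
  have 2: "R x" if "2 * int a + 4 \<le> x" "x < 4 * int j + 2 * int a + 4" for x
    unfolding R_def
    by (rule covers_index_zigzag[where u = "straight (a + 2)"
      and q = "2 * int a + 4" and n = j and v = "straight a @ [Turn]"])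
      (use that in \<open>simp_all add: endpoints\<close>)
  have 3: "R x" if "4 * int j + 2 * int a + 4 < x" "x < 4 * int j + 4 * int a + 4" "odd x" for x
    unfolding R_def
    by (rule covers_index_straight[where u = "straight (a + 2) @ zigzag j"
      and q = "4 * int j + 2 * int a + 4" and n = a and v = "[Turn]"])
      (use that in \<open>simp_all add: endpoints\<close>)
  have 4: "R (2 * int a + 1 + k) \<longleftrightarrow> R (2 * int a + 2 + k)"
    unfolding R_def
    by (rule covers_index_Turn[where u = "straight (a + 2) @ zigzag j @ straight a"
      and q = "4 * int j + 4 * int a + 4" and v = "[]"]) (simp_all add: endpoints k)
  have "covers k ?w (0, 1) c" for c
  proof (rule covers_if_covers_index)
    fix x assume x: "1 \<le> x" "x < 1 + k"
    have missing: "R (2 * int a + 2)"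
      using 1[of "2 * int a + 1"] 4 periodic[of "2 * int a + 1"] periodic[of "2 * int a + 2"]
      by simp
    consider "x = 2 * int a + 2" | "odd x" "x < 2 * int a + 4" | "even x" "2 \<le> x" "x \<le> 2 * int a"
      | "2 * int a + 4 \<le> x"
      by atomize_elim (use x in presburger)
    then have "R x"
      using missing 1[of x] 2[of x] 3[of "x + k"] periodic[of x] x by cases (simp_all add: k)
    then show "covers_index k ?w (0, 1) x" by (simp add: R_def)
  qed (use assms in simp_all)
  moreover have "k dvd fst (endpoint ?w (0, 1)) - (- 8 * int j - 4)"
    by (rule dvdI[of _ _ "4"]) (simp add: endpoints k)
  ultimately show ?thesis
    unfolding covering_word_def by (auto simp: endpoints k length_straight length_zigzag)
qed

text \<open>The second lap, shifted by \<open>k\<close>, fills all even gaps \<open>2\<close>, ...,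
  \<open>2 * a\<close> of the first run, so no turn outside the blocks is needed. The endpoint
  differs from the target by \<open>4 * k\<close>.\<close>

lemma covering_word_even_backward:
  assumes k: "k = 4 * int j + 2 * int a + 1"
  shows "covering_word k (- 8 * int j) 1
    (straight (a + 1) @ zigzag j @ straight a)"
    (is "covering_word _ _ _ ?w")
proof -
  define R where "R = covers_index k ?w (0, 1)"
  have periodic: "R (x + k) \<longleftrightarrow> R x" for x
    unfolding R_def by (rule covers_index_cong) simp
  have 1: "R x" if "0 < x" "x < 2 * int a + 2" "odd x" for x
    unfolding R_def
    by (rule covers_index_straight[where u = "[]"
      and q = 0 and n = "a + 1" and v = "zigzag j @ straight a"])
      (use that in \<open>simp_all add: endpoints\<close>)
  have 2: "R x" if "2 * int a + 2 \<le> x" "x < 4 * int j + 2 * int a + 2" for x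
    unfolding R_def
    by (rule covers_index_zigzag[where u = "straight (a + 1)"
      and q = "2 * int a + 2" and n = j and v = "straight a"])
      (use that in \<open>simp_all add: endpoints\<close>)
  have 3: "R x" if "4 * int j + 2 * int a + 2 < x" "x < 4 * int j + 4 * int a + 2" "odd x" for x
    unfolding R_def
    by (rule covers_index_straight[where u = "straight (a + 1) @ zigzag j"
      and q = "4 * int j + 2 * int a + 2" and n = a and v = "[]"])
      (use that in \<open>simp_all add: endpoints\<close>)
  have "covers k ?w (0, 1) c" for c
  proof (rule covers_if_covers_index)
    fix x assume x: "1 \<le> x" "x < 1 + k"
    consider "odd x" "x < 2 * int a + 2" | "even x" "2 \<le> x" "x \<le> 2 * int a" | "2 * int a + 2 \<le> x"
      by atomize_elim (use x in presburger)
    then have "R x"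
      using 1[of x] 2[of x] 3[of "x + k"] periodic[of x] x by cases (simp_all add: k)
    then show "covers_index k ?w (0, 1) x" by (simp add: R_def)
  qed (use assms in simp_all)
  moreover have "k dvd fst (endpoint ?w (0, 1)) - (- 8 * int j)"
    by (rule dvdI[of _ _ "4"]) (simp add: endpoints k)
  ultimately show ?thesis
    unfolding covering_word_def by (auto simp: endpoints k length_straight length_zigzag)
qed

text \<open>Two laps backward leave out \<open>0\<close> and \<open>- 2 * a - 3\<close>. The first
  turn ties \<open>0\<close> to \<open>1 - k\<close> modulo \<open>k\<close>, the last one
  \<open>- 2 * a - 3\<close> to \<open>- 2 * a - 2\<close>.\<close>

lemma covering_word_even_forward:
  assumes k: "k = 4 * int j + 2 * int a + 5"
  shows "covering_word k (8 * int j + 8) 1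
    ([Turn] @ straight (a + 2) @ zigzag j @ straight (a + 1) @ [Turn])"
    (is "covering_word _ _ _ ?w")
proof -
  define R where "R = covers_index k ?w (0, 1)"
  have periodic: "R (x + k) \<longleftrightarrow> R x" for x
    unfolding R_def by (rule covers_index_cong) simp
  have 1: "R 0 \<longleftrightarrow> R 1"
    unfolding R_def
    by (rule covers_index_Turn[where u = "[]"
      and q = 0 and v = "straight (a + 2) @ zigzag j @ straight (a + 1) @ [Turn]"]) (simp_all add: endpoints)
  have 2: "R x" if "- 2 * int a - 4 \<le> x" "x < 0" "even x" for x
    unfolding R_def
    by (rule covers_index_straight'[where u = "[Turn]"
      and q = 0 and n = "a + 2" and v = "zigzag j @ straight (a + 1) @ [Turn]"])
      (use that in \<open>simp_all add: endpoints\<close>)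
  have 3: "R x" if "- 4 * int j - 2 * int a - 4 \<le> x" "x < - 2 * int a - 4" for x
    unfolding R_def
    by (rule covers_index_zigzag'[where u = "[Turn] @ straight (a + 2)"
      and q = "- 2 * int a - 4" and n = j and v = "straight (a + 1) @ [Turn]"])
      (use that in \<open>simp_all add: endpoints\<close>)
  have 4: "R x" if "- 4 * int j - 4 * int a - 6 \<le> x" "x < - 4 * int j - 2 * int a - 4" "even x" for x
    unfolding R_def
    by (rule covers_index_straight'[where u = "[Turn] @ straight (a + 2) @ zigzag j"
      and q = "- 4 * int j - 2 * int a - 4" and n = "a + 1" and v = "[Turn]"])
      (use that in \<open>simp_all add: endpoints\<close>)
  have 5: "R (- 2 * int a - 2 - k) \<longleftrightarrow> R (- 2 * int a - 3 - k)"
    unfolding R_def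
    by (rule covers_index_Turn'[where u = "[Turn] @ straight (a + 2) @ zigzag j @ straight (a + 1)"
      and q = "- 4 * int j - 4 * int a - 6" and v = "[]"]) (simp_all add: endpoints k)
  have "covers k ?w (0, 1) c" for c
  proof (rule covers_if_covers_index)
    fix x assume x: "- k + 1 \<le> x" "x < - k + 1 + k"
    have "R (1 - k)"
      using 2[of "1 - k"] 3[of "1 - k"] by (cases "j = 0") (simp_all add: k)
    with 1 periodic[of "1 - k"] have zero: "R 0" by simp
    have missing: "R (- 2 * int a - 3)"
      using 2[of "- 2 * int a - 2"] 5 periodic[of "- 2 * int a - 2 - k"]
        periodic[of "- 2 * int a - 3 - k"] by simp
    consider "x = 0" | "x = - 2 * int a - 3" | "x < 0" "even x" "- 2 * int a - 4 \<le> x"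
      | "odd x" "- 2 * int a - 1 \<le> x" | "x < - 2 * int a - 4"
      by atomize_elim (use x in presburger)
    then have "R x"
      using zero missing 2[of x] 3[of x] 4[of "x - k"] periodic[of "x - k"] x by cases (simp_all add: k)
    then show "covers_index k ?w (0, 1) x" by (simp add: R_def)
  qed (use assms in simp_all)
  moreover have "k dvd fst (endpoint ?w (0, 1)) - (8 * int j + 8)"
    by (rule dvdI[of _ _ "- 4"]) (simp add: endpoints k)
  ultimately show ?thesis
    unfolding covering_word_def by (auto simp: endpoints k length_straight length_zigzag)
qed

text \<open>The run back is one advance shorter than the run out and misses \<open>4 * j\<close>,
  which the last turn ties to \<open>4 * j + 1\<close>. The first turn ties \<open>k - 1\<close> to
  \<open>0\<close>, which is covered by the zigzag or, for \<open>j = 0\<close>, by the last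
  turn.\<close>

lemma covering_word_odd_forward:
  assumes k: "k = 4 * int j + 2 * int a + 3"
  shows "covering_word k (8 * int j + 4) 1
    (zigzag j @ straight (a + 1) @ [Turn] @ straight a @ [Turn])"
    (is "covering_word _ _ _ ?w")
proof -
  define R where "R = covers_index k ?w (0, 1)"
  have periodic: "R (x + k) \<longleftrightarrow> R x" for x
    unfolding R_def by (rule covers_index_cong) simp
  have 1: "R x" if "0 \<le> x" "x < 4 * int j" for x
    unfolding R_def
    by (rule covers_index_zigzag[where u = "[]"
      and q = 0 and n = j and v = "straight (a + 1) @ [Turn] @ straight a @ [Turn]"])
      (use that in \<open>simp_all add: endpoints\<close>)
  have 2: "R x" if "4 * int j < x" "x < 4 * int j + 2 * int a + 2" "odd x" for x
    unfolding R_def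
    by (rule covers_index_straight[where u = "zigzag j"
      and q = "4 * int j" and n = "a + 1" and v = "[Turn] @ straight a @ [Turn]"])
      (use that in \<open>simp_all add: endpoints\<close>)
  have 3: "R (4 * int j + 2 * int a + 2) \<longleftrightarrow> R (4 * int j + 2 * int a + 3)"
    unfolding R_def
    by (rule covers_index_Turn[where u = "zigzag j @ straight (a + 1)"
      and q = "4 * int j + 2 * int a + 2" and v = "straight a @ [Turn]"]) (simp_all add: endpoints)
  have 4: "R x" if "4 * int j + 2 \<le> x" "x < 4 * int j + 2 * int a + 2" "even x" for x
    unfolding R_def
    by (rule covers_index_straight'[where u = "zigzag j @ straight (a + 1) @ [Turn]"
      and q = "4 * int j + 2 * int a + 2" and n = a and v = "[Turn]"])
      (use that in \<open>simp_all add: endpoints\<close>)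
  have 5: "R (4 * int j + 1) \<longleftrightarrow> R (4 * int j)"
    unfolding R_def
    by (rule covers_index_Turn'[where u = "zigzag j @ straight (a + 1) @ [Turn] @ straight a"
      and q = "4 * int j + 2" and v = "[]"]) (simp_all add: endpoints)
  have "covers k ?w (0, 1) c" for c
  proof (rule covers_if_covers_index)
    fix x assume x: "0 \<le> x" "x < 0 + k"
    have edge: "R (4 * int j)" using 2[of "4 * int j + 1"] 5 by simp
    then have "R 0" using 1[of 0] by (cases "j = 0") simp_all
    with 3 periodic[of 0] have last: "R (4 * int j + 2 * int a + 2)" by (simp add: k)
    consider "x < 4 * int j" | "x = 4 * int j" | "x = 4 * int j + 2 * int a + 2"
      | "odd x" "4 * int j < x" "x < 4 * int j + 2 * int a + 2"
      | "even x" "4 * int j + 2 \<le> x" "x < 4 * int j + 2 * int a + 2"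
      by atomize_elim (use x k in presburger)
    then have "R x"
      using edge last 1[of x] 2[of x] 4[of x] x by cases (simp_all add: k)
    then show "covers_index k ?w (0, 1) x" by (simp add: R_def)
  qed (use assms in simp_all)
  moreover have "k dvd fst (endpoint ?w (0, 1)) - (8 * int j + 4)"
    by (simp add: endpoints k)
  ultimately show ?thesis
    unfolding covering_word_def by (auto simp: endpoints k length_straight length_zigzag)
qed

text \<open>The runs and the zigzag leave out \<open>- 1\<close> and \<open>- k\<close>. Modulo
  \<open>k\<close>, the turns form a chain: the second ties \<open>- 1\<close> to
  \<open>- k\<close>, the first ties \<open>- k\<close> to \<open>1 - k\<close>.\<close>

lemma covering_word_odd_backward:
  assumes k: "k = 4 * int j + 2 * int a + 3"
  shows "covering_word k (- 8 * int j - 4) 1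
    ([Turn] @ straight 1 @ zigzag j @ straight a @ [Turn] @ straight a)"
    (is "covering_word _ _ _ ?w")
proof -
  define R where "R = covers_index k ?w (0, 1)"
  have periodic: "R (x + k) \<longleftrightarrow> R x" for x
    unfolding R_def by (rule covers_index_cong) simp
  have 1: "R 0 \<longleftrightarrow> R 1"
    unfolding R_def
    by (rule covers_index_Turn[where u = "[]"
      and q = 0 and v = "straight 1 @ zigzag j @ straight a @ [Turn] @ straight a"]) (simp_all add: endpoints)
  have 2: "R x" if "-2 \<le> x" "x < 0" "even x" for x
    unfolding R_def
    by (rule covers_index_straight'[where u = "[Turn]"
      and q = 0 and n = 1 and v = "zigzag j @ straight a @ [Turn] @ straight a"])
      (use that in \<open>simp_all add: endpoints\<close>)
  have 3: "R x" if "- 4 * int j - 2 \<le> x" "x < -2" for x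
    unfolding R_def
    by (rule covers_index_zigzag'[where u = "[Turn] @ straight 1"
      and q = "-2" and n = j and v = "straight a @ [Turn] @ straight a"])
      (use that in \<open>simp_all add: endpoints\<close>)
  have 4: "R x" if "- 4 * int j - 2 * int a - 2 \<le> x" "x < - 4 * int j - 2" "even x" for x
    unfolding R_def
    by (rule covers_index_straight'[where u = "[Turn] @ straight 1 @ zigzag j"
      and q = "- 4 * int j - 2" and n = a and v = "[Turn] @ straight a"])
      (use that in \<open>simp_all add: endpoints\<close>)
  have 5: "R (- 4 * int j - 2 * int a - 3) \<longleftrightarrow> R (- 4 * int j - 2 * int a - 4)"
    unfolding R_def
    by (rule covers_index_Turn'[where u = "[Turn] @ straight 1 @ zigzag j @ straight a"
      and q = "- 4 * int j - 2 * int a - 2" and v = "straight a"]) (simp_all add: endpoints)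
  have 6: "R x" if "- 4 * int j - 2 * int a - 2 < x" "x < - 4 * int j - 2" "odd x" for x
    unfolding R_def
    by (rule covers_index_straight[where u = "[Turn] @ straight 1 @ zigzag j @ straight a @ [Turn]"
      and q = "- 4 * int j - 2 * int a - 2" and n = a and v = "[]"])
      (use that in \<open>simp_all add: endpoints\<close>)
  have "covers k ?w (0, 1) c" for c
  proof (rule covers_if_covers_index)
    fix x assume x: "- k \<le> x" "x < - k + k"
    \<comment> \<open>The leftmost cell written backward belongs to the last nonempty piece: the
      straight run, the zigzag or the single advance.\<close>
    have "R (1 - k)"
      using 2[of "1 - k"] 3[of "1 - k"] 4[of "1 - k"] by (cases "a = 0"; cases "j = 0") (simp_all add: k)
    with 1 periodic[of "1 - k"] periodic[of "- k"] have first: "R (- k)" by simp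
    then have last: "R (- 1)" using 5 periodic[of "- k - 1"] by (simp add: k)
    have odd_x: "x \<noteq> 1 - k" if "odd x" using that by (auto simp: k)
    consider "x = - k" | "x = - 1" | "x = - 2" | "- 4 * int j - 2 \<le> x" "x < - 2"
      | "even x" "- k < x" "x < - 4 * int j - 2"
      | "odd x" "1 - k < x" "x < - 4 * int j - 2"
      by atomize_elim (use x odd_x in \<open>cases "even x"; simp; linarith\<close>)
    then have "R x"
      using first last 2[of x] 3[of x] 4[of x] 6[of x] by cases (simp_all add: k)
    then show "covers_index k ?w (0, 1) x" by (simp add: R_def)
  qed (use assms in simp_all)
  moreover have "k dvd fst (endpoint ?w (0, 1)) - (- 8 * int j - 4)"
    by (rule dvdI[of _ _ "0"]) (simp add: endpoints k)
  ultimately show ?thesis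
    unfolding covering_word_def by (auto simp: endpoints k length_straight length_zigzag)
qed

section \<open>The order of the Cayley digraph\<close>

text \<open>The displacement fixes the number of zigzag blocks as half of
  \<open>\<bar>D\<bar>\<close>, rounded down; the slack \<open>a = h - \<bar>D\<bar>\<close> goes
  into the straight runs.\<close>

lemma ex_covering_word:
  assumes k: "k = 2 * h + 1" and "h \<ge> 1" "\<bar>D\<bar> \<le> h" "e = 1 \<or> e = -1"
  shows "\<exists>w. covering_word k (4 * D) e w"
proof -
  define n where "n = nat \<bar>D\<bar>"
  define a where "a = nat (h - \<bar>D\<bar>)"
  have h: "h = int n + int a" using assms by (simp add: n_def a_def)
  consider "D = int n" | "D = - int n" "n > 0" by (cases "D \<ge> 0") (auto simp: n_def)
  then have D: "D = int n \<or> D = - int n \<and> n > 0" by metis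
  show ?thesis
  proof (cases "even n")
    case True
    then obtain j where n: "n = 2 * j" by (rule evenE)
    have kj: "k = 4 * int j + 2 * int a + 1" using k h n by simp
    have "k > 1" using assms by simp
    note flip = covering_word_even_forward_flip[OF kj \<open>k > 1\<close>]
      covering_word_even_backward_flip[OF kj \<open>k > 1\<close>]
    \<comment> \<open>The forward family starts at displacement 8, hence the shift to
      \<open>i\<close>; displacement 0 is taken from the backward family.\<close>
    have forward: "\<exists>w. covering_word k (8 * int j) 1 w"
    proof (cases j)
      case 0
      then show ?thesis using covering_word_even_backward[OF kj] by auto
    next
      case (Suc i)
      then have "k = 4 * int i + 2 * int a + 5" using kj by simp
      from covering_word_even_forward[OF this] show ?thesis using Suc by (auto simp: algebra_simps)
    qed
    show ?thesis
      using assms(4) D flip forward covering_word_even_backward[OF kj] by (auto simp: n)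
  next
    case False
    then obtain j where n: "n = 2 * j + 1" by (rule oddE)
    have kj: "k = 4 * int j + 2 * int a + 3" using k h n by simp
    have "4 * D = 8 * int j + 4 \<or> 4 * D = - 8 * int j - 4" using D n by auto
    then show ?thesis
      using assms(4) covering_word_odd_forward_flip[OF kj] covering_word_odd_backward_flip[OF kj]
        covering_word_odd_forward[OF kj] covering_word_odd_backward[OF kj]
      by (elim disjE) (simp_all only:, blast+)
  qed
qed

lemma quarter_mod_odd:
  fixes k h p :: int
  assumes k: "k = 2 * h + 1" and "h \<ge> 0"
  obtains D where "\<bar>D\<bar> \<le> h" "k dvd 4 * D - p"
proof
  \<comment> \<open>\<open>h * h\<close> is the inverse of 4 modulo \<open>k\<close>, since
    \<open>2 * h\<close> is \<open>-1\<close> there; adding and subtracting \<open>h\<close> yields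
    the balanced representative.\<close>
  define D where "D = (p * h * h + h) mod k - h"
  have "0 \<le> (p * h * h + h) mod k" "(p * h * h + h) mod k < k"
    using assms pos_mod_sign[of k] pos_mod_bound[of k] by auto
  then show "\<bar>D\<bar> \<le> h" using k by (simp add: D_def)
  obtain t where "(p * h * h + h) mod k = p * h * h + h - k * t"
    by (metis minus_mult_div_eq_mod)
  then have "4 * D - p = k * (p * (2 * h - 1) - 4 * t)"
    by (simp add: D_def k algebra_simps)
  then show "k dvd 4 * D - p" by simp
qed

lemma dihedral_wreath_subset_products:
  assumes "m > 0" "odd k" "k > 1"
  shows "carrier (dihedral_wreath m k) \<subseteq> products (dihedral_wreath m k) (generators m k) (nat k)"
proof
  fix x assume x: "x \<in> carrier (dihedral_wreath m k)"
  obtain f p e where x_eq: "x = (f, p, e)" by (cases x)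
  obtain h where h: "k = 2 * h + 1" using assms(2) by (rule oddE)
  have h1: "h \<ge> 1" using assms(3) h by simp
  obtain D where D: "\<bar>D\<bar> \<le> h" "k dvd 4 * D - p"
    using quarter_mod_odd[OF h, of p] h1 by auto
  have "e = 1 \<or> e = -1" using x by (simp add: x_eq dihedral_wreath_simps)
  then obtain w where w: "covering_word k (4 * D) e w"
    using ex_covering_word[OF h h1 D(1)] by blast
  have "k dvd (fst (endpoint w (0, 1)) - 4 * D) + (4 * D - p)"
    using w D(2) by (intro dvd_add) (simp_all add: covering_word_def)
  then show "x \<in> products (dihedral_wreath m k) (generators m k) (nat k)"
    using reachable_if_covers[of m k w f p e] assms w x
    by (auto simp: covering_word_def x_eq)
qed

text \<open>From \<open>d \<le> 3 * (d div 2)\<close> follows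
  \<open>d ^ k \<le> 3 ^ k * (d div 2) ^ k\<close>, and the hypothesis bounds \<open>3 ^ k\<close>
  by \<open>(d - 1) * 2 * k\<close>. Comparison with the geometric sum
  \<open>(d ^ k - 1) / (d - 1)\<close> gives strictness.\<close>

lemma sum_powers_less:
  fixes k d :: nat
  assumes "k > 0" "real d \<ge> 3 ^ k / (2 * real k) + 1"
  shows "(\<Sum>n<k. d ^ n) < 2 * k * (d div 2) ^ k"
proof -
  have "3 ^ k / (2 * real k) > 0" using assms(1) by simp
  then have "d \<ge> 2" using assms(2) by linarith
  then have "d \<le> 3 * (d div 2)" by linarith
  then have "real d \<le> 3 * real (d div 2)" by linarith
  then have "real d ^ k \<le> (3 * real (d div 2)) ^ k" by (intro power_mono) simp_all
  also have "\<dots> = 3 ^ k * real (d div 2) ^ k" by (simp add: power_mult_distrib)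
  also have "\<dots> \<le> ((real d - 1) * (2 * real k)) * real (d div 2) ^ k"
    using assms by (intro mult_right_mono) (simp_all add: field_simps)
  finally have le: "real d ^ k \<le> (real d - 1) * (2 * real k * real (d div 2) ^ k)"
    by (simp only: mult.assoc)
  have "(real d - 1) * (\<Sum>n<k. real d ^ n) = real d ^ k - 1"
    by (simp add: power_diff_1_eq)
  with le have "(real d - 1) * (\<Sum>n<k. real d ^ n) < (real d - 1) * (2 * real k * real (d div 2) ^ k)"
    by linarith
  then have "(\<Sum>n<k. real d ^ n) < 2 * real k * real (d div 2) ^ k"
    using \<open>d \<ge> 2\<close> by (simp add: mult_less_cancel_left_pos)
  then have "real (\<Sum>n<k. d ^ n) < real (2 * k * (d div 2) ^ k)" by simp
  then show ?thesis by (simp only: of_nat_less_iff)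
qed

theorem mainTheorem9:
  fixes k d :: nat
  assumes "k \<ge> 3" and "odd k"
    and "real d \<ge> 3 ^ k / (2 * real k) + 1"
  shows "cayley_number d k \<ge> 2 * k * (d div 2) ^ k"
proof -
  have less: "(\<Sum>n<k. d ^ n) < 2 * k * (d div 2) ^ k"
    using assms by (intro sum_powers_less) simp_all
  \<comment> \<open>For \<open>d div 2 = 0\<close> the right-hand side of \<open>less\<close> would
    be zero.\<close>
  then have m: "int (d div 2) > 0" using assms(1) by (cases "d div 2") (auto simp: power_0_left)
  have k: "int k > 0" "odd (int k)" "int k > 1" using assms by simp_all
  let ?G = "dihedral_wreath (int (d div 2)) (int k)"
  let ?X = "generators (int (d div 2)) (int k)"
  interpret group ?G by (rule group_dihedral_wreath[OF m k(1)])
  have order: "order ?G = 2 * k * (d div 2) ^ k"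
    using finite_order_dihedral_wreath(2)[OF m k(1)] by simp
  have "\<not> int k dvd 4"
  proof
    assume "int k dvd 4"
    then have "k dvd 4" using int_dvd_int_iff[of k 4] by simp
    then have "k \<le> 4" by (simp add: dvd_imp_le)
    with assms(1,2) have "k = 3" by presburger
    with \<open>k dvd 4\<close> show False by simp
  qed
  then have "\<one>\<^bsub>?G\<^esub> \<notin> ?X" by (rule one_notin_generators)
  \<comment> \<open>Twice \<open>d div 2\<close> is \<open>d\<close> or \<open>d - 1\<close>; the
    padding in \<open>order_le_cayley_number\<close> makes up any shortfall.\<close>
  moreover have "card ?X \<le> d"
    using card_generators_le[of "int (d div 2)" "int k"] by simp
  ultimately have "order ?G \<le> cayley_number d k"
    using order_le_cayley_number[of ?X k d] finite_order_dihedral_wreath(1)[OF m k(1)]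
      generators_subset[OF m k(1)] dihedral_wreath_subset_products[OF m k(2,3)] less order assms(1)
    by simp
  then show ?thesis by (simp only: order)
qed

end
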